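(* Let $(X, p)$ be a compact pseudometric space, and let $T : G \curvearrowright X$ be a continuous action of a locally compact unimodular topological group $G$ (not necessarily amenable) on $X$. Let $\mu$ be a regular Borel probability measure on $X$. Assume that there exist measurable functions $H, L : G \to (0, \infty)$ such that $$p(T_g x, T_g y) \leq L(g) \cdot p(x, y)^{H(g)} \qquad (\forall g \in G,\ x \in X,\ y \in X).$$ Let $x_0 \in X$. Let $(F_i)_{i \in \mathscr{I}}$ be a net of compact subsets of $G$ with positive Haar measure. Let $(C_i)_{i \in \mathscr{I}}$ be a net of measurable subsets of $X$ such that $\mu(C_i) > 0$ and $x_0 \in C_i$ for all $i \in \mathscr{I}$. Suppose that for every $\delta > 0$, $$\lim_i \frac{m\left( \left\{ g \in F_i : L(g) \cdot \operatorname{diam}(C_i)^{H(g)} > \delta \right\} \right)}{m(F_i)} = 0 .$$ Let $f : X \to \mathbb{C}$ be a uniformly bounded continuous function. Then $$\lim_i \left| \left( \operatorname{Avg}_{F_i} f \right)(x_0) - \alpha_{C_i}\left( \operatorname{Avg}_{F_i} f \right) \right| = 0 .$$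
   Context: $m$ denotes a (bi-invariant) Haar measure on $G$. For a compact $K \subseteq G$ with $m(K)>0$ and $f \in C(X)$, $\operatorname{Avg}_K f(x) = \frac{1}{m(K)} \int_K f(T_g x) \, \mathrm{d}m(g)$, a continuous function on $X$. For a measurable $C \subseteq X$ with $\mu(C)>0$, $\alpha_C(h) = \frac{1}{\mu(C)} \int_C h \, \mathrm{d}\mu$. $\operatorname{diam}(C) = \sup_{x,y \in C} p(x,y)$. The measure $\mu$ is not assumed to be $T$-invariant. *)

theory Defs
  imports "HOL-Probability.Probability"
begin

definition pseudometric :: "('x \<Rightarrow> 'x \<Rightarrow> real) \<Rightarrow> bool" where
  "pseudometric p \<longleftrightarrow>
     (\<forall>x y. 0 \<le> p x y) \<and> (\<forall>x. p x x = 0) \<and> (\<forall>x y. p x y = p y x) \<and>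
     (\<forall>x y z. p x z \<le> p x y + p y z)"

text \<open>The topology of the type is the (possibly non-Hausdorff) one generated by the open
  \<^term>\<open>p\<close>-balls.\<close>
definition compact_pseudometric_space :: "('x::topological_space \<Rightarrow> 'x \<Rightarrow> real) \<Rightarrow> bool" where
  "compact_pseudometric_space p \<longleftrightarrow>
     pseudometric p \<and>
     (\<forall>U. open U \<longleftrightarrow> (\<forall>x\<in>U. \<exists>r>0. \<forall>y. p x y < r \<longrightarrow> y \<in> U)) \<and>
     compact (UNIV :: 'x set)"

definition pdiam :: "('x \<Rightarrow> 'x \<Rightarrow> real) \<Rightarrow> 'x set \<Rightarrow> real" where
  "pdiam p C = (SUP z\<in>C \<times> C. p (fst z) (snd z))"

text \<open>Groups are written additively because the library's class of topological groups is additive;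
  commutativity is not part of that class.\<close>
definition continuous_action ::
    "('g::topological_group_add \<Rightarrow> 'x::topological_space \<Rightarrow> 'x) \<Rightarrow> bool" where
  "continuous_action T \<longleftrightarrow>
     (\<forall>x. T 0 x = x) \<and> (\<forall>g h x. T (g + h) x = T g (T h x)) \<and>
     continuous_on UNIV (\<lambda>(g, x). T g x)"

definition outer_regular_at :: "'a::topological_space measure \<Rightarrow> 'a set \<Rightarrow> bool" where
  "outer_regular_at M A \<longleftrightarrow> emeasure M A = (INF U\<in>{U. open U \<and> A \<subseteq> U}. emeasure M U)"

text \<open>Compact sets need not be Borel in a non-Hausdorff space.\<close>
definition inner_regular_at :: "'a::topological_space measure \<Rightarrow> 'a set \<Rightarrow> bool" where
  "inner_regular_at M A \<longleftrightarrow>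
     emeasure M A = (SUP K\<in>{K. compact K \<and> K \<in> sets M \<and> K \<subseteq> A}. emeasure M K)"

definition regular_borel_probability :: "'a::topological_space measure \<Rightarrow> bool" where
  "regular_borel_probability M \<longleftrightarrow>
     sets M = sets borel \<and> prob_space M \<and>
     (\<forall>A\<in>sets M. outer_regular_at M A \<and> inner_regular_at M A)"

definition radon_measure :: "'a::t2_space measure \<Rightarrow> bool" where
  "radon_measure M \<longleftrightarrow>
     sets M = sets borel \<and> (\<forall>K. compact K \<longrightarrow> emeasure M K < \<infinity>) \<and>
     (\<forall>A\<in>sets M. outer_regular_at M A) \<and> (\<forall>U. open U \<longrightarrow> inner_regular_at M U)"

definition left_invariant :: "'g::topological_group_add measure \<Rightarrow> bool" where
  "left_invariant M \<longleftrightarrow> (\<forall>g. \<forall>A\<in>sets M. emeasure M ((\<lambda>x. g + x) ` A) = emeasure M A)"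

definition right_invariant :: "'g::topological_group_add measure \<Rightarrow> bool" where
  "right_invariant M \<longleftrightarrow> (\<forall>g. \<forall>A\<in>sets M. emeasure M ((\<lambda>x. x + g) ` A) = emeasure M A)"

definition left_haar_measure :: "'g::{topological_group_add,t2_space} measure \<Rightarrow> bool" where
  "left_haar_measure M \<longleftrightarrow>
     radon_measure M \<and> emeasure M UNIV \<noteq> 0 \<and> left_invariant M"

definition unimodular_group :: "'g::{topological_group_add,t2_space} itself \<Rightarrow> bool" where
  "unimodular_group TYPE('g) \<longleftrightarrow>
     (\<forall>M :: 'g measure. left_haar_measure M \<longrightarrow> right_invariant M)"

definition haar_average ::
    "'g measure \<Rightarrow> ('g \<Rightarrow> 'x \<Rightarrow> 'x) \<Rightarrow> 'g set \<Rightarrow> ('x \<Rightarrow> complex) \<Rightarrow> 'x \<Rightarrow> complex" where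
  "haar_average m T K f x = (1 / measure m K) *\<^sub>R (LINT g:K|m. f (T g x))"

definition mean_over :: "'x measure \<Rightarrow> 'x set \<Rightarrow> ('x \<Rightarrow> complex) \<Rightarrow> complex" where
  "mean_over \<mu> C h = (1 / measure \<mu> C) *\<^sub>R (LINT x:C|\<mu>. h x)"

definition directed_index :: "'i set \<Rightarrow> ('i \<Rightarrow> 'i \<Rightarrow> bool) \<Rightarrow> bool" where
  "directed_index I le \<longleftrightarrow>
     I \<noteq> {} \<and> (\<forall>i\<in>I. le i i) \<and>
     (\<forall>i\<in>I. \<forall>j\<in>I. \<forall>k\<in>I. le i j \<longrightarrow> le j k \<longrightarrow> le i k) \<and>
     (\<forall>i\<in>I. \<forall>j\<in>I. \<exists>k\<in>I. le i k \<and> le j k)"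

text \<open>A net indexed by \<^term>\<open>I\<close> is a function restricted to \<^term>\<open>I\<close>; its limits are the
  limits along the filter of tails.\<close>
definition net_filter :: "'i set \<Rightarrow> ('i \<Rightarrow> 'i \<Rightarrow> bool) \<Rightarrow> 'i filter" where
  "net_filter I le = (INF i\<in>I. principal {j\<in>I. le i j})"

lemma eventually_net_filter:
  assumes "directed_index I le"
  shows "eventually P (net_filter I le) \<longleftrightarrow> (\<exists>i\<in>I. \<forall>j\<in>I. le i j \<longrightarrow> P j)"
proof -
  have ne: "I \<noteq> {}"
    using assms unfolding directed_index_def by (rule conjunct1)
  have tr: "\<forall>i\<in>I. \<forall>j\<in>I. \<forall>k\<in>I. le i j \<longrightarrow> le j k \<longrightarrow> le i k"
    using assms unfolding directed_index_def by (elim conjE)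
  have dir: "\<forall>i\<in>I. \<forall>j\<in>I. \<exists>k\<in>I. le i k \<and> le j k"
    using assms unfolding directed_index_def by (elim conjE)
  have "eventually P (net_filter I le) \<longleftrightarrow> (\<exists>i\<in>I. eventually P (principal {j\<in>I. le i j}))"
    unfolding net_filter_def
  proof (rule eventually_INF_base[OF ne])
    fix i j assume ij: "i \<in> I" "j \<in> I"
    obtain k where k: "k \<in> I" "le i k" "le j k"
      using dir[rule_format, OF ij] by (elim bexE conjE)
    have "{l\<in>I. le k l} \<subseteq> {l\<in>I. le i l} \<inter> {l\<in>I. le j l}"
      using tr[rule_format, OF ij(1) k(1) _ k(2)] tr[rule_format, OF ij(2) k(1) _ k(3)] by auto
    then show "\<exists>x\<in>I. principal {l\<in>I. le x l}
        \<le> inf (principal {l\<in>I. le i l}) (principal {l\<in>I. le j l})"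
      using k(1) by auto
  qed
  then show ?thesis by (auto simp: eventually_principal)
qed

end

theory Submission
  imports Defs
begin

text \<open>A continuous function on a compact pseudometric space is bounded and uniformly continuous.
  Fix \<open>\<delta>\<close> witnessing uniform continuity for \<open>\<epsilon>\<close>. For \<open>x \<in> C i\<close> the points \<open>T g x0\<close> and \<open>T g x\<close> are
  within \<open>\<delta>\<close> of each other unless \<open>g\<close> lies in the exceptional set of the hypothesis, so
  the averages of \<open>f\<close> at \<open>x0\<close> and \<open>x\<close> differ by at most \<open>\<epsilon>\<close> plus a constant times the relative
  measure of that set. This is uniform in \<open>x \<in> C i\<close>, so it survives averaging over \<open>C i\<close>;
  joint continuity of the action makes the averages continuous in \<open>x\<close>, hence integrable there.\<close>

lemma compact_pseudometricD:
  fixes p :: "'x::topological_space \<Rightarrow> 'x \<Rightarrow> real"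
  assumes "compact_pseudometric_space p"
  shows "0 \<le> p x y" "p x x = 0" "p x y = p y x" "p x z \<le> p x y + p y z"
    and "open U \<longleftrightarrow> (\<forall>x\<in>U. \<exists>r>0. \<forall>y. p x y < r \<longrightarrow> y \<in> U)"
    and "compact (UNIV :: 'x set)"
proof -
  have ps: "pseudometric p"
    using assms unfolding compact_pseudometric_space_def by (elim conjE)
  have "\<forall>U. open U \<longleftrightarrow> (\<forall>x\<in>U. \<exists>r>0. \<forall>y. p x y < r \<longrightarrow> y \<in> U)"
    using assms unfolding compact_pseudometric_space_def by (elim conjE)
  then show "open U \<longleftrightarrow> (\<forall>x\<in>U. \<exists>r>0. \<forall>y. p x y < r \<longrightarrow> y \<in> U)" by (rule spec)
  show "compact (UNIV :: 'x set)"
    using assms unfolding compact_pseudometric_space_def by (elim conjE)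
  have "\<forall>x y. 0 \<le> p x y" using ps unfolding pseudometric_def by (elim conjE)
  then show "0 \<le> p x y" by iprover
  have "\<forall>x. p x x = 0" using ps unfolding pseudometric_def by (elim conjE)
  then show "p x x = 0" by iprover
  have "\<forall>x y. p x y = p y x" using ps unfolding pseudometric_def by (elim conjE)
  then show "p x y = p y x" by iprover
  have "\<forall>x y z. p x z \<le> p x y + p y z" using ps unfolding pseudometric_def by (elim conjE)
  then show "p x z \<le> p x y + p y z" by iprover
qed

lemma open_pball:
  assumes "compact_pseudometric_space p"
  shows "open {y. p x y < r}"
proof -
  note tri = compact_pseudometricD(4)[OF assms] and op = compact_pseudometricD(5)[OF assms]
  show ?thesis unfolding op
  proof
    fix y assume y: "y \<in> {y. p x y < r}"
    show "\<exists>s>0. \<forall>z. p y z < s \<longrightarrow> z \<in> {y. p x y < r}"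
    proof (intro exI[of _ "r - p x y"] conjI allI impI)
      fix z assume "p y z < r - p x y"
      then show "z \<in> {y. p x y < r}" using tri[of x z y] by simp
    qed (use y in simp)
  qed
qed

text \<open>Each point lies in its own open ball, so these balls cover the compact space. The radius
  may vary with the centre because the Lebesgue number argument for uniform continuity needs this;
  boundedness uses the constant radius 1.\<close>

lemma compact_pseudometric_finite_subcover:
  assumes cp: "compact_pseudometric_space p" and d: "\<And>x. 0 < d x"
  obtains A where "finite A" "\<And>y. \<exists>x\<in>A. p x y < d x"
proof -
  note self = compact_pseudometricD(2)[OF cp] and comp = compact_pseudometricD(6)[OF cp]
  have cov: "UNIV \<subseteq> (\<Union>x\<in>UNIV. {y. p x y < d x})"
    using self d by auto
  obtain A where "finite A" "UNIV \<subseteq> (\<Union>x\<in>A. {y. p x y < d x})"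
    using compactE_image[OF comp _ cov] open_pball[OF cp] by metis
  then show ?thesis by (intro that[of A]) auto
qed

text \<open>Finitely many unit balls cover the space. Passing from one point to another through two
  centres costs less than 1 at each end, and there are only finitely many distances between
  centres.\<close>

lemma compact_pseudometric_bounded:
  assumes cp: "compact_pseudometric_space p"
  obtains B where "\<And>x y. p x y \<le> B"
proof -
  note sym = compact_pseudometricD(3)[OF cp] and tri = compact_pseudometricD(4)[OF cp]
  obtain A where A: "finite A" "\<And>y. \<exists>x\<in>A. p x y < 1"
    using compact_pseudometric_finite_subcover[OF cp, of "\<lambda>_. 1"] by auto
  define M where "M = Max ((\<lambda>(a, b). p a b) ` (A \<times> A))"
  have "p x y \<le> M + 2" for x y
  proof -
    obtain a b where ab: "a \<in> A" "p a x < 1" "b \<in> A" "p b y < 1" using A(2) by meson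
    have "p a b \<le> M" unfolding M_def using ab A(1) by (intro Max_ge) auto
    then show ?thesis using tri[of x y a] tri[of a y b] sym[of x a] ab by linarith
  qed
  then show ?thesis by (rule that)
qed

text \<open>Lebesgue number argument: \<open>f\<close> stays within \<open>e / 2\<close> of
  \<open>f a\<close> on the ball of radius \<open>2 * r a\<close> about \<open>a\<close>, while
  finitely many balls of half that radius already cover the space.\<close>

lemma compact_pseudometric_uniformly_continuous:
  fixes f :: "'x::topological_space \<Rightarrow> 'b::metric_space"
  assumes cp: "compact_pseudometric_space p" and f: "continuous_on UNIV f" and e: "0 < e"
  obtains d where "0 < d" "\<And>x y. p x y < d \<Longrightarrow> dist (f x) (f y) < e"
proof -
  note tri = compact_pseudometricD(4)[OF cp] and op = compact_pseudometricD(5)[OF cp]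
  have "\<exists>r>0. \<forall>y. p x y < 2 * r \<longrightarrow> dist (f x) (f y) < e / 2" for x
  proof -
    have "open (f -` ball (f x) (e / 2))"
      using f by (intro open_vimage) auto
    moreover have "x \<in> f -` ball (f x) (e / 2)" using e by simp
    ultimately obtain r where "r > 0" "\<forall>y. p x y < r \<longrightarrow> y \<in> f -` ball (f x) (e / 2)"
      unfolding op by blast
    then show ?thesis by (intro exI[of _ "r / 2"]) auto
  qed
  then obtain r where r: "\<And>x. 0 < r x"
    and fr: "\<And>x y. p x y < 2 * r x \<Longrightarrow> dist (f x) (f y) < e / 2"
    by metis
  obtain A where A: "finite A" "\<And>y. \<exists>x\<in>A. p x y < r x"
    using compact_pseudometric_finite_subcover[OF cp, of r, OF r] by blast
  have "A \<noteq> {}" using A(2) by blast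
  show ?thesis
  \<comment> \<open>If \<open>x\<close> is within \<open>r a\<close> of a centre \<open>a\<close>,
    every point closer to \<open>x\<close> than the minimum stays inside the doubled ball about
    \<open>a\<close>; two errors of \<open>e / 2\<close> then add up.\<close>
  proof (rule that[of "Min (r ` A)"])
    show "0 < Min (r ` A)" using A(1) \<open>A \<noteq> {}\<close> r by auto
    fix x y assume xy: "p x y < Min (r ` A)"
    obtain a where a: "a \<in> A" "p a x < r a" using A(2) by blast
    have "p x y < r a" using xy a(1) A(1) by (meson Min_le finite_imageI imageI order_less_le_trans)
    then have "p a y < 2 * r a" using tri[of a y x] a(2) by linarith
    moreover have "p a x < 2 * r a" using a(2) r[of a] by linarith
    ultimately show "dist (f x) (f y) < e"
      using fr[of a y] fr[of a x] dist_triangle_half_r by blast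
  qed
qed

text \<open>A real supremum is sure to bound its set only if the set is bounded above; compactness
  of the space provides that.\<close>

lemma le_pdiam:
  assumes cp: "compact_pseudometric_space p" and "x \<in> C" "y \<in> C"
  shows "p x y \<le> pdiam p C"
proof -
  obtain B where "\<And>x y. p x y \<le> B" using compact_pseudometric_bounded[OF cp] by blast
  then have "bdd_above ((\<lambda>z. p (fst z) (snd z)) ` (C \<times> C))" by (auto intro!: bdd_aboveI2)
  then show ?thesis
    using cSUP_upper[of "(x, y)" "C \<times> C" "\<lambda>z. p (fst z) (snd z)"] assms
    unfolding pdiam_def by simp
qed

lemma set_integrable_bounded:
  fixes h :: "'a \<Rightarrow> 'b::{banach, second_countable_topology}"
  assumes "A \<in> sets M" "emeasure M A < \<infinity>" "h \<in> borel_measurable M"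
    and "\<And>x. x \<in> A \<Longrightarrow> norm (h x) \<le> B"
  shows "set_integrable M A h"
  unfolding set_integrable_def
proof (rule integrableI_bounded_set[where A = A and B = B])
  show "(\<lambda>x. indicat_real A x *\<^sub>R h x) \<in> borel_measurable M"
    using assms(1,3) by measurable
  show "AE x in M. x \<in> A \<longrightarrow> norm (indicat_real A x *\<^sub>R h x) \<le> B"
    using assms(4) by (auto simp: indicator_def)
qed (use assms in auto)

text \<open>The constant \<open>a\<close> is its own mean over \<open>C\<close>, so the difference
  is the mean of \<open>a - h\<close>.\<close>

lemma norm_mean_over_diff_le:
  assumes C: "C \<in> sets M" "emeasure M C < \<infinity>" "0 < measure M C"
    and h: "set_integrable M C h" and B: "\<And>x. x \<in> C \<Longrightarrow> cmod (a - h x) \<le> B"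
  shows "cmod (a - mean_over M C h) \<le> B"
proof -
  have const: "set_integrable M C (\<lambda>_. c)" for c :: "'c::{banach, second_countable_topology}"
    using C by (intro set_integrable_bounded[where B = "norm c"]) auto
  have int: "(LINT x:C|M. c) = measure M C *\<^sub>R c" for c :: "'c::{banach, second_countable_topology}"
    using C by (simp add: set_lebesgue_integral_def)
  have "(LINT x:C|M. a - h x) = measure M C *\<^sub>R a - (LINT x:C|M. h x)"
    using set_integral_diff(2)[OF const[of a] h] int[of a] by simp
  then have "a - mean_over M C h = (1 / measure M C) *\<^sub>R (LINT x:C|M. a - h x)"
    using C(3) by (simp add: mean_over_def scaleR_diff_right)
  then have eq: "cmod (a - mean_over M C h) = cmod (LINT x:C|M. a - h x) / measure M C"
    using C(3) by simp
  have "cmod (LINT x:C|M. a - h x) \<le> (LINT x:C|M. cmod (a - h x))"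
    by (rule set_integral_norm_bound[OF set_integral_diff(1)[OF const h]])
  also have "\<dots> \<le> (LINT x:C|M. B)"
    using B by (intro set_integral_mono set_integrable_norm set_integral_diff(1) const h)
  finally show ?thesis
    unfolding eq using C(3) by (simp add: int divide_le_eq mult.commute)
qed

text \<open>On \<open>F\<close> the norm of \<open>u - v\<close> is dominated by \<open>e\<close>
  plus \<open>B\<close> times the indicator of the exceptional set \<open>E\<close>; integrating
  this bound gives the two terms.\<close>

lemma norm_set_integral_diff_le:
  fixes u v :: "'a \<Rightarrow> 'b::{banach, second_countable_topology}"
  assumes F: "F \<in> sets M" "emeasure M F < \<infinity>" and E: "E \<in> sets M" "E \<subseteq> F"
    and u: "set_integrable M F u" and v: "set_integrable M F v"
    and e: "0 \<le> e" "\<And>x. x \<in> F - E \<Longrightarrow> norm (u x - v x) \<le> e"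
    and B: "\<And>x. x \<in> E \<Longrightarrow> norm (u x - v x) \<le> B"
  shows "norm ((LINT x:F|M. u x) - (LINT x:F|M. v x)) \<le> e * measure M F + B * measure M E"
proof -
  have fE: "emeasure M E < \<infinity>" using F E by (meson emeasure_mono order_le_less_trans)
  have ie: "set_integrable M F (\<lambda>_. e)"
    using F by (intro set_integrable_bounded[where B = "norm e"]) auto
  have iB: "integrable M (\<lambda>x. indicat_real E x * B)"
    using E(1) fE by simp
  have eq: "indicat_real F x *\<^sub>R (indicat_real E x * B) = indicat_real E x * B" for x
    using E(2) by (auto simp: indicator_def)
  have iB': "set_integrable M F (\<lambda>x. indicat_real E x * B)"
    unfolding set_integrable_def eq by (rule iB)
  have "norm ((LINT x:F|M. u x) - (LINT x:F|M. v x)) = norm (LINT x:F|M. u x - v x)"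
    using set_integral_diff(2)[OF u v] by simp
  also have "\<dots> \<le> (LINT x:F|M. norm (u x - v x))"
    by (rule set_integral_norm_bound[OF set_integral_diff(1)[OF u v]])
  also have "\<dots> \<le> (LINT x:F|M. e + indicat_real E x * B)"
  proof (intro set_integral_mono set_integrable_norm set_integral_diff(1) set_integral_add(1) u v ie iB')
    fix x assume "x \<in> F"
    then show "norm (u x - v x) \<le> e + indicat_real E x * B"
      using e(1) e(2)[of x] B[of x] by (cases "x \<in> E") (auto simp: indicator_def)
  qed
  also have "\<dots> = (LINT x:F|M. e) + (LINT x:F|M. indicat_real E x * B)"
    by (rule set_integral_add(2)[OF ie iB'])
  also have "\<dots> = e * measure M F + B * measure M E"
  proof -
    have "(LINT x:F|M. e) = e * measure M F"
      using F by (simp add: set_lebesgue_integral_def)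
    moreover have "(LINT x:F|M. indicat_real E x * B) = B * measure M E"
      unfolding set_lebesgue_integral_def eq using E(1) fE by simp
    ultimately show ?thesis by simp
  qed
  finally show ?thesis .
qed

text \<open>Compactness of \<open>K\<close> makes the continuity of the integrand at
  \<open>x\<close> uniform in \<open>g\<close>, as in the tube lemma, and \<open>K\<close> has
  finite measure.\<close>

lemma continuous_on_haar_average:
  fixes T :: "'g::topological_space \<Rightarrow> 'x::topological_space \<Rightarrow> 'x" and f :: "'x \<Rightarrow> complex"
  assumes K: "compact K" "K \<in> sets m" "emeasure m K < \<infinity>"
    and T: "continuous_on UNIV (\<lambda>(g, x). T g x)" and f: "continuous_on UNIV f"
    and int: "\<And>x. set_integrable m K (\<lambda>g. f (T g x))"
  shows "continuous_on UNIV (haar_average m T K f)"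
proof -
  have "((\<lambda>y. LINT g:K|m. f (T g y)) \<longlongrightarrow> (LINT g:K|m. f (T g x))) (at x)" for x
  proof (rule tendstoI)
    fix e :: real assume e: "0 < e"
    \<comment> \<open>The summand 1 keeps the denominator positive when \<open>K\<close> is a null
      set and makes the final inequality strict.\<close>
    define d where "d = e / (measure m K + 1)"
    have pos: "0 < measure m K + 1" by (simp add: add_nonneg_pos)
    then have d: "0 < d" using e by (simp add: d_def)
    moreover have "d * (measure m K + 1) = e" using pos by (simp add: d_def)
    ultimately have de: "d * measure m K < e" by (simp add: distrib_left)
    have "continuous_on (UNIV \<times> K) (\<lambda>z. f (T (snd z) (fst z)))"
    proof -
      \<comment> \<open>The coordinates are swapped so that the compact factor comes second, as
        \<open>continuous_on_prod_compactE\<close> expects.\<close>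
      have "continuous_on UNIV (\<lambda>z. f ((\<lambda>(g, x). T g x) (snd z, fst z)))"
        by (intro continuous_on_compose2[OF f] continuous_on_compose2[OF T] continuous_intros) auto
      then show ?thesis by (auto intro: continuous_on_subset)
    qed
    then obtain X where X: "x \<in> X" "open X"
      and fX: "\<forall>y\<in>X \<inter> UNIV. \<forall>g\<in>K.
          dist (f (T (snd (y, g)) (fst (y, g)))) (f (T (snd (x, g)) (fst (x, g)))) \<le> d"
      using continuous_on_prod_compactE[OF _ K(1) UNIV_I d] by blast
    have "dist (LINT g:K|m. f (T g y)) (LINT g:K|m. f (T g x)) < e" if "y \<in> X" for y
    proof -
      \<comment> \<open>The bound holds on all of \<open>K\<close>, so the exceptional set is taken
        empty.\<close>
      have "cmod ((LINT g:K|m. f (T g y)) - (LINT g:K|m. f (T g x)))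
          \<le> d * measure m K + 0 * measure m {}"
        using fX that d
        by (intro norm_set_integral_diff_le K int) (auto simp: dist_norm)
      then show ?thesis using de by (simp add: dist_norm)
    qed
    then show "\<forall>\<^sub>F y in at x. dist (LINT g:K|m. f (T g y)) (LINT g:K|m. f (T g x)) < e"
      using X by (auto simp: eventually_at_topological)
  qed
  then have "continuous_on UNIV (\<lambda>y. LINT g:K|m. f (T g y))"
    by (simp add: continuous_on_def)
  then show ?thesis unfolding haar_average_def[abs_def] by (intro continuous_intros)
qed

theorem theorem3p4:
  fixes p :: "'x::topological_space \<Rightarrow> 'x \<Rightarrow> real"
    and T :: "'g::{topological_group_add,t2_space} \<Rightarrow> 'x \<Rightarrow> 'x"
    and m :: "'g measure"
    and \<mu> :: "'x measure"
    and H L :: "'g \<Rightarrow> real"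
    and x0 :: 'x
    and I :: "'i set"
    and le :: "'i \<Rightarrow> 'i \<Rightarrow> bool"
    and F :: "'i \<Rightarrow> 'g set"
    and C :: "'i \<Rightarrow> 'x set"
    and f :: "'x \<Rightarrow> complex"
  assumes "compact_pseudometric_space p"
    and "locally compact (UNIV :: 'g set)"
    and "unimodular_group TYPE('g)"
    and "left_haar_measure m"
    and "continuous_action T"
    and "regular_borel_probability \<mu>"
    and "H \<in> borel_measurable borel" and "\<forall>g. 0 < H g"
    and "L \<in> borel_measurable borel" and "\<forall>g. 0 < L g"
    and "\<forall>g x y. p (T g x) (T g y) \<le> L g * p x y powr H g"
    and "directed_index I le"
    and "\<forall>i\<in>I. compact (F i) \<and> 0 < emeasure m (F i)"
    and "\<forall>i\<in>I. C i \<in> sets \<mu> \<and> 0 < emeasure \<mu> (C i) \<and> x0 \<in> C i"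
    and "\<forall>\<delta>>0. ((\<lambda>i. measure m {g \<in> F i. L g * pdiam p (C i) powr H g > \<delta>} / measure m (F i))
            \<longlongrightarrow> 0) (net_filter I le)"
    and "continuous_on UNIV f" and "bounded (range f)"
  shows "((\<lambda>i. cmod (haar_average m T (F i) f x0 - mean_over \<mu> (C i) (haar_average m T (F i) f)))
            \<longlongrightarrow> 0) (net_filter I le)"
proof -
  have radon: "radon_measure m" and prob: "prob_space \<mu>"
    and sets_m: "sets m = sets borel" and sets_mu: "sets \<mu> = sets borel"
    and Tc: "continuous_on UNIV (\<lambda>(g, x). T g x)"
    using assms(4,5,6) unfolding left_haar_measure_def
      radon_measure_def regular_borel_probability_def continuous_action_def by auto
  have fin_compact: "\<forall>K. compact K \<longrightarrow> emeasure m K < \<infinity>"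
    using radon unfolding radon_measure_def by (elim conjE)
  interpret prob_space \<mu> by (rule prob)
  note p_nonneg = compact_pseudometricD(1)[OF assms(1)]
  obtain B where B: "\<And>x. cmod (f x) \<le> B"
    using assms(17) by (auto simp: bounded_iff)
  have F: "F i \<in> sets m" "emeasure m (F i) < \<infinity>" "0 < measure m (F i)" "compact (F i)"
    if "i \<in> I" for i
  proof -
    show c: "compact (F i)" using assms(13) that by blast
    \<comment> \<open>The group is Hausdorff, so compact sets are closed and hence Borel.\<close>
    show "F i \<in> sets m" using c by (simp add: sets_m borel_closed compact_imp_closed)
    show fin: "emeasure m (F i) < \<infinity>" using fin_compact c by iprover
    show "0 < measure m (F i)"
      using bspec[OF assms(13) that] fin by (simp add: measure_def enn2real_positive_iff)
  qed
  have C: "C i \<in> sets \<mu>" "0 < measure \<mu> (C i)" "x0 \<in> C i" if "i \<in> I" for i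
    using bspec[OF assms(14) that] by (simp_all add: emeasure_eq_measure)
  have meas: "(\<lambda>g. f (T g x)) \<in> borel_measurable m" for x
  proof -
    have "continuous_on UNIV (\<lambda>g. f ((\<lambda>(g, x). T g x) (g, x)))"
      by (intro continuous_on_compose2[OF assms(16)] continuous_on_compose2[OF Tc] continuous_intros)
        auto
    then have "(\<lambda>g. f (T g x)) \<in> borel_measurable borel"
      by (intro borel_measurable_continuous_onI) simp
    then show ?thesis by (simp add: measurable_cong_sets[OF sets_m refl])
  qed
  have int: "set_integrable m (F i) (\<lambda>g. f (T g x))" if "i \<in> I" for i x
    using F[OF that] B by (intro set_integrable_bounded[where B = B] meas) auto
  define bad where "bad = (\<lambda>d i. {g \<in> F i. L g * pdiam p (C i) powr H g > d})"
  have bad: "bad d i \<in> sets m" if "i \<in> I" for d i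
  proof -
    have [measurable]: "H \<in> borel_measurable m" "L \<in> borel_measurable m"
      using assms(7,9) by (simp_all add: measurable_cong_sets[OF sets_m refl])
    have "{g \<in> space m. L g * pdiam p (C i) powr H g > d} \<in> sets m" by measurable
    moreover have "bad d i = F i \<inter> {g \<in> space m. L g * pdiam p (C i) powr H g > d}"
      using sets.sets_into_space[OF F(1)[OF that]] by (auto simp: bad_def)
    ultimately show ?thesis using F(1)[OF that] by simp
  qed
  \<comment> \<open>The right-hand side does not depend on the point \<open>x\<close> of
    \<open>C i\<close>, so the bound survives averaging over \<open>C i\<close>.\<close>
  have key: "cmod (haar_average m T (F i) f x0 - haar_average m T (F i) f x)
      \<le> e + 2 * B * (measure m (bad d i) / measure m (F i))"
    if i: "i \<in> I" and x: "x \<in> C i" and e: "0 < e"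
      and d: "\<And>y z. p y z \<le> d \<Longrightarrow> cmod (f y - f z) \<le> e" for i x e d
  proof -
    have "cmod (f (T g x0) - f (T g x)) \<le> e" if g: "g \<in> F i - bad d i" for g
    proof (rule d)
      have "p (T g x0) (T g x) \<le> L g * p x0 x powr H g" using assms(11) by blast
      \<comment> \<open>Both \<open>x0\<close> and \<open>x\<close> lie in \<open>C i\<close>, and
        powers with the positive exponent \<open>H g\<close> are monotone on nonnegative
        reals.\<close>
      also have "\<dots> \<le> L g * pdiam p (C i) powr H g"
        using assms(8,10) p_nonneg le_pdiam[OF assms(1) C(3)[OF i] x]
        by (intro mult_left_mono powr_mono2) (auto simp: less_imp_le)
      also have "\<dots> \<le> d" using g by (auto simp: bad_def)
      finally show "p (T g x0) (T g x) \<le> d" .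
    qed
    moreover have "cmod (f y - f z) \<le> 2 * B" for y z
      using norm_triangle_ineq4[of "f y" "f z"] B[of y] B[of z] by linarith
    ultimately have "cmod ((LINT g:F i|m. f (T g x0)) - (LINT g:F i|m. f (T g x)))
        \<le> e * measure m (F i) + 2 * B * measure m (bad d i)"
      using F[OF i] bad[OF i] e
      by (intro norm_set_integral_diff_le int[OF i]) (auto simp: bad_def)
    then have "cmod ((LINT g:F i|m. f (T g x0)) - (LINT g:F i|m. f (T g x))) / measure m (F i)
        \<le> e + 2 * B * (measure m (bad d i) / measure m (F i))"
      using F(3)[OF i] by (simp add: field_simps)
    then show ?thesis
      using F(3)[OF i] by (simp add: haar_average_def flip: scaleR_diff_right)
  qed
  have avg_int: "set_integrable \<mu> (C i) (haar_average m T (F i) f)" if i: "i \<in> I" for i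
  proof (rule set_integrable_bounded)
    show "haar_average m T (F i) f \<in> borel_measurable \<mu>"
      unfolding measurable_cong_sets[OF sets_mu refl]
      by (intro borel_measurable_continuous_onI continuous_on_haar_average F[OF i] Tc assms(16) int[OF i])
    fix x assume "x \<in> C i"
    \<comment> \<open>The Haar average is the mean over \<open>F i\<close> of the orbit function;
      comparing it with the constant 0 bounds it by \<open>B\<close>.\<close>
    have "cmod (0 - mean_over m (F i) (\<lambda>g. f (T g x))) \<le> B"
      using B by (intro norm_mean_over_diff_le F[OF i] int[OF i]) auto
    then show "cmod (haar_average m T (F i) f x) \<le> B"
      by (simp add: haar_average_def mean_over_def)
  qed (use C[OF i] in \<open>auto simp: emeasure_eq_measure\<close>)
  \<comment> \<open>The hypotheses on the sets \<open>F i\<close> and \<open>C i\<close> hold only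
    for indices in \<open>I\<close>; every tail generating the filter lies in
    \<open>I\<close>.\<close>
  have in_I: "\<forall>\<^sub>F i in net_filter I le. i \<in> I"
    unfolding net_filter_def
  proof -
    obtain i where "i \<in> I" using assms(12) unfolding directed_index_def by blast
    then show "\<forall>\<^sub>F i in (INF i\<in>I. principal {j\<in>I. le i j}). i \<in> I"
      by (intro eventually_INF1[of i]) (auto simp: eventually_principal)
  qed
  show ?thesis
  proof (rule tendstoI)
    fix e :: real assume e: "0 < e"
    obtain d' where d': "0 < d'" "\<And>y z. p y z < d' \<Longrightarrow> dist (f y) (f z) < e / 2"
      by (rule compact_pseudometric_uniformly_continuous[OF assms(1,16) half_gt_zero[OF e]]) iprover
    \<comment> \<open>Outside \<open>bad d i\<close> only a non-strict bound by \<open>d\<close> is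
      known; halving \<open>d'\<close> turns it into the strict one that uniform continuity
      needs.\<close>
    define d where "d = d' / 2"
    have d: "0 < d" using d'(1) by (simp add: d_def)
    have fd: "cmod (f y - f z) \<le> e / 2" if "p y z \<le> d" for y z
      using d'(1) d'(2)[of y z] that by (auto simp: d_def dist_norm)
    have "((\<lambda>i. measure m (bad d i) / measure m (F i)) \<longlongrightarrow> 0) (net_filter I le)"
      using assms(15) d by (simp add: bad_def)
    then have "((\<lambda>i. e / 2 + 2 * B * (measure m (bad d i) / measure m (F i)))
        \<longlongrightarrow> e / 2 + 2 * B * 0) (net_filter I le)"
      by (intro tendsto_intros)
    \<comment> \<open>The limit \<open>e / 2\<close> lies strictly below \<open>e\<close>, so the
      values are eventually below \<open>e\<close>.\<close>
    then have "\<forall>\<^sub>F i in net_filter I le.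
        e / 2 + 2 * B * (measure m (bad d i) / measure m (F i)) < e"
      by (rule order_tendstoD(2)) (use e in simp)
    then show "\<forall>\<^sub>F i in net_filter I le. dist (cmod (haar_average m T (F i) f x0
        - mean_over \<mu> (C i) (haar_average m T (F i) f))) 0 < e"
      using in_I
    proof eventually_elim
      case (elim i)
      have "cmod (haar_average m T (F i) f x0 - mean_over \<mu> (C i) (haar_average m T (F i) f))
          \<le> e / 2 + 2 * B * (measure m (bad d i) / measure m (F i))"
        using C[OF elim(2)] avg_int[OF elim(2)] e
        by (intro norm_mean_over_diff_le key elim(2) fd) (auto simp: emeasure_eq_measure)
      then show ?case using elim(1) by simp
    qed
  qed
qed

end
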